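(* Let $S$ be a $p\times p$ positive semidefinite matrix and $n\ge 1$. If $\int_{-\infty}^{\infty}\pi(x)\,dx<\infty$ and $\int_0^\infty x^{n/2}\pi_D(x)\,dx<\infty$, then the posterior $p(\Theta\mid S)$ is proper.
   Context: Fix an integer $p\ge 1$; $n$ is a positive integer (the sample size). All matrices are real symmetric $p\times p$, and $\Theta=(\theta_{ij})\succ 0$ means $\Theta$ is positive definite. The functions $\pi_D:(0,\infty)\to[0,\infty)$ and $\pi:\mathbb{R}\to[0,\infty)$ are continuous. They define the (possibly improper) separable prior $$p(\Theta)\propto\prod_{i=1}^p\pi_D(\theta_{ii})\prod_{i<j}\pi(\theta_{ij})\,\mathbb{I}(\Theta\succ 0),$$ and the posterior given $S$ is $$p(\Theta\mid S)\propto\det(\Theta)^{n/2}\exp\!\left(-\frac n2\mathrm{tr}(S\Theta)\right)\prod_{i=1}^p\pi_D(\theta_{ii})\prod_{i<j}\pi(\theta_{ij})\,\mathbb{I}(\Theta\succ 0).$$ The posterior is called proper if this unnormalised density has finite integral over the cone of positive definite matrices with respect to Lebesgue measure $d\Theta=\prod_{i\le j}d\theta_{ij}$ on the upper triangular entries. *)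

theory Defs
  imports "HOL-Analysis.Analysis"
begin

text \<open>The number of rows \<open>p \<ge> 1\<close> is \<open>CARD('n)\<close>. The linear order on the index type
  serves only to tell the upper triangular entries from the lower ones.\<close>

type_synonym 'n sq_matrix = "((real, 'n) vec, 'n) vec"

definition positive_semidefinite :: "('n::finite) sq_matrix \<Rightarrow> bool" where
  "positive_semidefinite A \<longleftrightarrow> transpose A = A \<and> (\<forall>x. 0 \<le> x \<bullet> (A *v x))"

definition positive_definite :: "('n::finite) sq_matrix \<Rightarrow> bool" where
  "positive_definite A \<longleftrightarrow> transpose A = A \<and> (\<forall>x. x \<noteq> 0 \<longrightarrow> 0 < x \<bullet> (A *v x))"

text \<open>Only the values of \<open>\<pi>\<^sub>D\<close> on \<open>(0,\<infinity>)\<close> matter: a positive definite matrix has a positive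
  diagonal, and elsewhere the indicator makes the density vanish.\<close>

definition prior_density ::
  "(real \<Rightarrow> real) \<Rightarrow> (real \<Rightarrow> real) \<Rightarrow> ('n::{finite,linorder}) sq_matrix \<Rightarrow> real" where
  "prior_density \<pi>\<^sub>D \<pi> \<Theta> =
     (\<Prod>i\<in>UNIV. \<pi>\<^sub>D (\<Theta> $ i $ i)) * (\<Prod>(i, j)\<in>{(i, j). i < j}. \<pi> (\<Theta> $ i $ j)) *
     indicator {\<Theta>. positive_definite \<Theta>} \<Theta>"

definition posterior_density ::
  "(real \<Rightarrow> real) \<Rightarrow> (real \<Rightarrow> real) \<Rightarrow> nat \<Rightarrow> ('n::{finite,linorder}) sq_matrix \<Rightarrow>
   'n sq_matrix \<Rightarrow> real" where
  "posterior_density \<pi>\<^sub>D \<pi> n S \<Theta> =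
     det \<Theta> powr (real n / 2) * exp (- (real n / 2) * trace (S ** \<Theta>)) * prior_density \<pi>\<^sub>D \<pi> \<Theta>"

definition sym_matrix :: "('n \<times> 'n \<Rightarrow> real) \<Rightarrow> ('n::{finite,linorder}) sq_matrix" where
  "sym_matrix u = (\<chi> i j. u (min i j, max i j))"

definition upper_lborel :: "(('n::{finite,linorder}) \<times> 'n \<Rightarrow> real) measure" where
  "upper_lborel = (\<Pi>\<^sub>M ij\<in>{(i, j). i \<le> j}. lborel)"

text \<open>For the nonnegative densities considered here, \<open>integrable\<close> means measurable with
  finite integral.\<close>

definition proper_posterior ::
  "(real \<Rightarrow> real) \<Rightarrow> (real \<Rightarrow> real) \<Rightarrow> nat \<Rightarrow> ('n::{finite,linorder}) sq_matrix \<Rightarrow> bool" where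
  "proper_posterior \<pi>\<^sub>D \<pi> n S \<longleftrightarrow>
     integrable upper_lborel (\<lambda>u. posterior_density \<pi>\<^sub>D \<pi> n S (sym_matrix u))"

end

theory Submission
  imports Defs
begin

text \<open>On the positive definite cone, \<open>\<theta>\<^sub>i\<^sub>j\<^sup>2 \<le> \<theta>\<^sub>i\<^sub>i \<theta>\<^sub>j\<^sub>j\<close>, so every term of the Leibniz expansion of
  \<open>det \<Theta>\<close> is at most \<open>\<Prod>\<^sub>i \<theta>\<^sub>i\<^sub>i\<close> in absolute value; this replaces Hadamard's inequality at the
  cost of a constant factor \<open>p!\<close>. Moreover \<open>tr(S\<Theta>) \<ge> 0\<close>, so the exponential factor is at most 1.
  The posterior density is thus dominated by a constant times
  \<open>\<Prod>\<^sub>i \<theta>\<^sub>i\<^sub>i\<^bsup>n/2\<^esup> \<pi>\<^sub>D(\<theta>\<^sub>i\<^sub>i) \<Prod>\<^sub>i\<^sub><\<^sub>j \<pi>(\<theta>\<^sub>i\<^sub>j)\<close>, a product of integrable functions of separate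
  coordinates.\<close>

section \<open>Bounds on entries and determinants of positive definite matrices\<close>

lemma quadratic_form_sum:
  fixes A :: "'n::finite sq_matrix"
  shows "x \<bullet> (A *v x) = (\<Sum>i\<in>UNIV. \<Sum>j\<in>UNIV. A $ i $ j * (x $ i * x $ j))"
  by (simp add: inner_vec_def matrix_vector_mult_def sum_distrib_left mult_ac)

lemma positive_definite_sym:
  "positive_definite A \<Longrightarrow> A $ i $ j = A $ j $ i"
  unfolding positive_definite_def transpose_def by (metis vec_lambda_beta)

text \<open>Evaluates the form at a vector supported on two coordinates; this isolates a 2x2
  principal submatrix.\<close>

lemma positive_definite_quadratic_two:
  fixes A :: "'n::finite sq_matrix"
  assumes "positive_definite A" "i \<noteq> j" "a \<noteq> 0 \<or> b \<noteq> 0"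
  shows "0 < a\<^sup>2 * A $ i $ i + 2 * a * b * A $ i $ j + b\<^sup>2 * A $ j $ j"
proof -
  define x :: "real ^ 'n" where "x = a *\<^sub>R axis i 1 + b *\<^sub>R axis j 1"
  have "x $ i = a" "x $ j = b"
    using assms(2) by (auto simp: x_def axis_def)
  then have "x \<noteq> 0"
    using assms(3) by (metis zero_index)
  then have "0 < x \<bullet> (A *v x)"
    using assms(1) by (simp add: positive_definite_def)
  also have "x \<bullet> (A *v x) = a\<^sup>2 * A $ i $ i + 2 * a * b * A $ i $ j + b\<^sup>2 * A $ j $ j"
  proof -
    have "A *v x = a *\<^sub>R column i A + b *\<^sub>R column j A"
      by (simp add: x_def matrix_vector_right_distrib matrix_vector_mult_scaleR
          matrix_vector_mult_basis)
    then show ?thesis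
      using positive_definite_sym[OF assms(1), of i j]
      by (simp add: x_def inner_add_left inner_axis' column_def power2_eq_square algebra_simps)
  qed
  finally show ?thesis .
qed

lemma positive_definite_diag_pos:
  fixes A :: "'n::finite sq_matrix"
  assumes "positive_definite A"
  shows "0 < A $ i $ i"
proof -
  have "0 < axis i 1 \<bullet> (A *v axis i 1)"
    using assms unfolding positive_definite_def by (simp add: axis_eq_0_iff)
  also have "\<dots> = A $ i $ i"
    by (simp add: inner_axis' matrix_vector_mult_basis column_def)
  finally show ?thesis .
qed

lemma positive_definite_entry_square_le:
  fixes A :: "'n::finite sq_matrix"
  assumes "positive_definite A"
  shows "(A $ i $ j)\<^sup>2 \<le> A $ i $ i * A $ j $ j"
proof (cases "i = j")
  case True
  then show ?thesis by (simp add: power2_eq_square)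
next
  case False
  let ?d = "A $ i $ i" and ?b = "A $ i $ j"
  have d: "0 < ?d" by (rule positive_definite_diag_pos[OF assms])
  \<comment> \<open>The coefficients \<open>- ?b\<close> and \<open>?d\<close> make the form factor
    as \<open>?d\<close> times the 2x2 principal minor, so the minor is positive.\<close>
  have "0 < (- ?b)\<^sup>2 * ?d + 2 * (- ?b) * ?d * ?b + ?d\<^sup>2 * A $ j $ j"
    using positive_definite_quadratic_two[OF assms False, of "- ?b" ?d] d by simp
  also have "\<dots> = ?d * (?d * A $ j $ j - ?b\<^sup>2)"
    by (simp add: power2_eq_square algebra_simps)
  finally show ?thesis
    using d by (simp add: zero_less_mult_iff)
qed

lemma abs_det_le_prod_diag:
  fixes A :: "'n::finite sq_matrix"
  assumes "positive_definite A"
  shows "\<bar>det A\<bar> \<le> fact CARD('n) * (\<Prod>i\<in>UNIV. A $ i $ i)"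
proof -
  have nonneg: "0 \<le> (\<Prod>i\<in>UNIV. A $ i $ i)"
    by (intro prod_nonneg ballI less_imp_le positive_definite_diag_pos[OF assms])
  have term_le: "\<bar>\<Prod>i\<in>UNIV. A $ i $ p i\<bar> \<le> (\<Prod>i\<in>UNIV. A $ i $ i)"
    if p: "p permutes UNIV" for p
  \<comment> \<open>After squaring, the entrywise bound applies factor by factor. The diagonal
    entries at \<open>p i\<close> are those at \<open>i\<close> reordered, so the product of the
    bounds is a perfect square.\<close>
  proof (rule power2_le_imp_le[OF _ nonneg])
    have "\<bar>\<Prod>i\<in>UNIV. A $ i $ p i\<bar>\<^sup>2 = (\<Prod>i\<in>UNIV. (A $ i $ p i)\<^sup>2)"
      by (simp add: prod_power_distrib)
    also have "\<dots> \<le> (\<Prod>i\<in>UNIV. A $ i $ i * A $ p i $ p i)"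
      by (intro prod_mono conjI positive_definite_entry_square_le[OF assms]) simp
    also have "\<dots> = (\<Prod>i\<in>UNIV. A $ i $ i)\<^sup>2"
      using prod.permute[OF p, of "\<lambda>i. A $ i $ i"]
      by (simp add: prod.distrib power2_eq_square o_def)
    finally show "\<bar>\<Prod>i\<in>UNIV. A $ i $ p i\<bar>\<^sup>2 \<le> (\<Prod>i\<in>UNIV. A $ i $ i)\<^sup>2" .
  qed
  have "\<bar>det A\<bar> \<le> (\<Sum>p\<in>{p. p permutes (UNIV :: 'n set)}. \<bar>of_int (sign p) * (\<Prod>i\<in>UNIV. A $ i $ p i)\<bar>)"
    unfolding det_def by (rule sum_abs)
  also have "\<dots> \<le> (\<Sum>p\<in>{p. p permutes (UNIV :: 'n set)}. \<Prod>i\<in>UNIV. A $ i $ i)"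
    using term_le by (intro sum_mono) (auto simp: abs_mult sign_def)
  also have "\<dots> = fact CARD('n) * (\<Prod>i\<in>UNIV. A $ i $ i)"
    by (simp add: card_permutations)
  finally show ?thesis .
qed

section \<open>Nonnegativity of the trace of a product\<close>

text \<open>Eliminating the index \<open>k\<close> replaces \<open>\<theta>\<close> by its Schur complement, which differs from \<open>\<theta>\<close> by a
  rank one matrix \<open>v v\<^sup>T\<close>; the latter contributes the value of the form \<open>s\<close> at \<open>v\<close>.\<close>

lemma sum_mult_positive_definite_nonneg:
  fixes s \<theta> :: "'a \<Rightarrow> 'a \<Rightarrow> real"
  assumes "finite B"
    and "\<And>i j. \<theta> i j = \<theta> j i"
    and "\<And>x. \<exists>i\<in>B. x i \<noteq> 0 \<Longrightarrow> 0 < (\<Sum>i\<in>B. \<Sum>j\<in>B. \<theta> i j * (x i * x j))"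
    and "\<And>C x. C \<subseteq> B \<Longrightarrow> 0 \<le> (\<Sum>i\<in>C. \<Sum>j\<in>C. s i j * (x i * x j))"
  shows "0 \<le> (\<Sum>i\<in>B. \<Sum>j\<in>B. s i j * \<theta> i j)"
  using assms
\<comment> \<open>\<open>\<theta>\<close> stays arbitrary because the induction hypothesis is
  applied to the Schur complement. The condition on \<open>s\<close>, stated for all subsets, passes
  directly to the smaller index set.\<close>
proof (induction B arbitrary: \<theta> rule: finite_induct)
  case empty
  then show ?case by simp
next
  case (insert k B)
  note sym = insert.prems(1) and pd = insert.prems(2) and psd = insert.prems(3)
  define d where "d = \<theta> k k"
  have split: "(\<Sum>i\<in>insert k B. \<Sum>j\<in>insert k B. f i j) =
      f k k + (\<Sum>j\<in>B. f k j) + (\<Sum>i\<in>B. f i k) + (\<Sum>i\<in>B. \<Sum>j\<in>B. f i j)"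
    for f :: "'a \<Rightarrow> 'a \<Rightarrow> real"
    using insert.hyps by (simp add: sum.distrib)
  have d: "0 < d"
  proof -
    define e where "e i = (if i = k then 1 else 0 :: real)" for i
    have e: "e k = 1" "\<And>i. i \<in> B \<Longrightarrow> e i = 0"
      using insert.hyps by (auto simp: e_def)
    have "0 < (\<Sum>i\<in>insert k B. \<Sum>j\<in>insert k B. \<theta> i j * (e i * e j))"
      by (rule pd) (auto simp: e)
    also have "\<dots> = d"
      unfolding split by (simp add: d_def e)
    finally show ?thesis .
  qed
  define \<theta>' where "\<theta>' i j = \<theta> i j - \<theta> i k * \<theta> j k / d" for i j
  have "0 \<le> (\<Sum>i\<in>B. \<Sum>j\<in>B. s i j * \<theta>' i j)"
  proof (rule insert.IH)
    show "\<theta>' i j = \<theta>' j i" for i j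
      using sym[of i j] by (simp add: \<theta>'_def mult.commute)
    show "0 < (\<Sum>i\<in>B. \<Sum>j\<in>B. \<theta>' i j * (x i * x j))" if x: "\<exists>i\<in>B. x i \<noteq> 0" for x
    proof -
      define w where "w = (\<Sum>i\<in>B. \<theta> i k * x i)"
      \<comment> \<open>With \<open>x\<close> fixed on \<open>B\<close>, the form is a quadratic
        \<open>d * t\<^sup>2 + 2 * w * t\<close> plus a constant in the coordinate \<open>t\<close>
        at \<open>k\<close>. Its minimiser is \<open>- w / d\<close>, and the minimum is the form of
        \<open>\<theta>'\<close> at \<open>x\<close>.\<close>
      define y where "y i = (if i = k then - w / d else x i)" for i
      have yB: "y i = x i" if "i \<in> B" for i
        using that insert.hyps by (auto simp: y_def)
      have yk: "y k = - w / d" by (simp add: y_def)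
      have "0 < (\<Sum>i\<in>insert k B. \<Sum>j\<in>insert k B. \<theta> i j * (y i * y j))"
        using x yB by (intro pd) force
      also have "\<dots> = d * (w / d)\<^sup>2 + 2 * (- w / d) * w + (\<Sum>i\<in>B. \<Sum>j\<in>B. \<theta> i j * (x i * x j))"
      proof -
        have "(\<Sum>i\<in>B. \<theta> i k * (y i * y k)) = (- w / d) * w"
          by (subst (2) w_def) (simp add: sum_distrib_left yB yk mult_ac cong: sum.cong)
        moreover have "(\<Sum>j\<in>B. \<theta> k j * (y k * y j)) = (\<Sum>i\<in>B. \<theta> i k * (y i * y k))"
          by (intro sum.cong) (auto simp: sym[of k] mult_ac)
        moreover have "(\<Sum>i\<in>B. \<Sum>j\<in>B. \<theta> i j * (y i * y j)) = (\<Sum>i\<in>B. \<Sum>j\<in>B. \<theta> i j * (x i * x j))"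
          by (intro sum.cong) (auto simp: yB)
        ultimately show ?thesis
          unfolding split by (simp add: yk d_def[symmetric] power2_eq_square)
      qed
      also have "\<dots> = (\<Sum>i\<in>B. \<Sum>j\<in>B. \<theta> i j * (x i * x j)) - w * w / d"
        using d by (simp add: power2_eq_square)
      also have "\<dots> = (\<Sum>i\<in>B. \<Sum>j\<in>B. \<theta>' i j * (x i * x j))"
        unfolding w_def sum_product
        by (simp add: \<theta>'_def left_diff_distrib right_diff_distrib sum_subtractf
            sum_divide_distrib mult_ac)
      finally show ?thesis .
    qed
    show "0 \<le> (\<Sum>i\<in>C. \<Sum>j\<in>C. s i j * (x i * x j))" if "C \<subseteq> B" for C x
      using that by (intro psd) auto
  qed
  \<comment> \<open>Row and column \<open>k\<close> of the Schur complement vanish, so its sum over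
    \<open>B\<close> equals the sum over the enlarged index set.\<close>
  moreover have "\<theta>' k j = 0" "\<theta>' i k = 0" for i j
    using d sym[of j k] by (simp_all add: \<theta>'_def d_def[symmetric])
  then have "(\<Sum>i\<in>B. \<Sum>j\<in>B. s i j * \<theta>' i j) = (\<Sum>i\<in>insert k B. \<Sum>j\<in>insert k B. s i j * \<theta>' i j)"
    unfolding split by simp
  moreover have "0 \<le> (\<Sum>i\<in>insert k B. \<Sum>j\<in>insert k B. s i j * (\<theta> i k * \<theta> j k)) / d"
    using psd[OF subset_refl, of "\<lambda>i. \<theta> i k"] d by (rule divide_nonneg_pos)
  moreover have "(\<Sum>i\<in>insert k B. \<Sum>j\<in>insert k B. s i j * \<theta> i j) =
      (\<Sum>i\<in>insert k B. \<Sum>j\<in>insert k B. s i j * \<theta>' i j) +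
      (\<Sum>i\<in>insert k B. \<Sum>j\<in>insert k B. s i j * (\<theta> i k * \<theta> j k)) / d"
    unfolding sum_divide_distrib sum.distrib[symmetric]
    by (intro sum.cong refl) (simp add: \<theta>'_def algebra_simps)
  ultimately show ?case by linarith
qed

lemma trace_mult_nonneg:
  fixes S A :: "'n::finite sq_matrix"
  assumes S: "positive_semidefinite S" and A: "positive_definite A"
  shows "0 \<le> trace (S ** A)"
proof -
  have "0 \<le> (\<Sum>i\<in>UNIV. \<Sum>j\<in>UNIV. S $ i $ j * A $ i $ j)"
  proof (rule sum_mult_positive_definite_nonneg)
    show "A $ i $ j = A $ j $ i" for i j
      by (rule positive_definite_sym[OF A])
    show "0 < (\<Sum>i\<in>UNIV. \<Sum>j\<in>UNIV. A $ i $ j * (x i * x j))" if "\<exists>i\<in>UNIV. x i \<noteq> 0" for x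
    proof -
      have "(\<chi> i. x i) \<noteq> 0"
        using that by (auto simp: vec_eq_iff)
      then have "0 < (\<chi> i. x i) \<bullet> (A *v (\<chi> i. x i))"
        using A by (simp add: positive_definite_def)
      then show ?thesis by (simp add: quadratic_form_sum)
    qed
    show "0 \<le> (\<Sum>i\<in>C. \<Sum>j\<in>C. S $ i $ j * (x i * x j))" for C x
    proof -
      \<comment> \<open>Padding \<open>x\<close> by zeros outside \<open>C\<close> reduces the
        principal submatrix on \<open>C\<close> to the full form of \<open>S\<close>.\<close>
      define y where "y i = (if i \<in> C then x i else 0)" for i
      have "0 \<le> (\<chi> i. y i) \<bullet> (S *v (\<chi> i. y i))"
        using S by (simp add: positive_semidefinite_def)
      also have "\<dots> = (\<Sum>i\<in>UNIV. \<Sum>j\<in>UNIV. S $ i $ j * (y i * y j))"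
        by (simp add: quadratic_form_sum)
      also have "\<dots> = (\<Sum>i\<in>C. \<Sum>j\<in>UNIV. S $ i $ j * (y i * y j))"
        by (intro sum.mono_neutral_right) (auto simp: y_def)
      also have "\<dots> = (\<Sum>i\<in>C. \<Sum>j\<in>C. S $ i $ j * (x i * x j))"
        by (intro sum.cong refl sum.mono_neutral_cong_right) (auto simp: y_def)
      finally show ?thesis .
    qed
  qed simp
  also have "\<dots> = trace (S ** A)"
    using positive_definite_sym[OF A] by (simp add: trace_def matrix_matrix_mult_def)
  finally show ?thesis .
qed

section \<open>Measurability of the cone and of the posterior density\<close>

text \<open>By compactness the form attains a positive minimum on the unit sphere, and homogeneity
  of degree two spreads this bound to all vectors. Bounds of the form \<open>1 / Suc m\<close>
  exhibit the cone as a countable union of closed sets, hence as a Borel set.\<close>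

lemma positive_definite_iff_uniform:
  fixes A :: "'n::finite sq_matrix"
  shows "positive_definite A \<longleftrightarrow>
    transpose A = A \<and> (\<exists>m. \<forall>x. x \<bullet> x / real (Suc m) \<le> x \<bullet> (A *v x))"
proof safe
  assume A: "positive_definite A"
  then show "transpose A = A" by (simp add: positive_definite_def)
  have "continuous_on (sphere 0 1) (\<lambda>x :: real ^ 'n. x \<bullet> (A *v x))"
    by (intro continuous_intros matrix_vector_mult_linear_continuous_on)
  moreover have "sphere 0 1 \<noteq> ({} :: (real ^ 'n) set)" by simp
  ultimately obtain x0 :: "real ^ 'n" where x0: "norm x0 = 1"
    and le: "\<And>x. norm x = 1 \<Longrightarrow> x0 \<bullet> (A *v x0) \<le> x \<bullet> (A *v x)"
    using continuous_attains_inf[OF compact_sphere] by (metis (no_types, lifting) mem_sphere_0)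
  have "0 < x0 \<bullet> (A *v x0)"
    using A x0 unfolding positive_definite_def by (metis norm_zero zero_neq_one)
  then obtain m where m: "inverse (real (Suc m)) < x0 \<bullet> (A *v x0)"
    using reals_Archimedean by blast
  have "x \<bullet> x / real (Suc m) \<le> x \<bullet> (A *v x)" for x
  proof (cases "x = 0")
    case False
    let ?r = "norm x"
    have r: "0 < ?r" using False by simp
    have "inverse (real (Suc m)) \<le> (x /\<^sub>R ?r) \<bullet> (A *v (x /\<^sub>R ?r))"
      using m le[of "x /\<^sub>R ?r"] r by simp
    also have "\<dots> = (x \<bullet> (A *v x)) / ?r\<^sup>2"
      by (simp add: matrix_vector_mult_scaleR divide_inverse power2_eq_square mult_ac)
    finally have "inverse (real (Suc m)) * ?r\<^sup>2 \<le> x \<bullet> (A *v x)"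
      using r by (simp add: pos_le_divide_eq)
    then show ?thesis
      by (simp add: divide_inverse power2_norm_eq_inner mult.commute)
  qed simp
  then show "\<exists>m. \<forall>x. x \<bullet> x / real (Suc m) \<le> x \<bullet> (A *v x)" by blast
next
  fix m
  assume "transpose A = A" and m: "\<forall>x. x \<bullet> x / real (Suc m) \<le> x \<bullet> (A *v x)"
  have "0 < x \<bullet> (A *v x)" if "x \<noteq> 0" for x
  proof -
    have "0 < x \<bullet> x / real (Suc m)" using that by simp
    also have "\<dots> \<le> x \<bullet> (A *v x)" using m by blast
    finally show ?thesis .
  qed
  then show "positive_definite A"
    using \<open>transpose A = A\<close> by (simp add: positive_definite_def)
qed

lemma sets_positive_definite [measurable]:
  "{A :: 'n::finite sq_matrix. positive_definite A} \<in> sets borel"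
proof -
  have entry: "continuous_on UNIV (\<lambda>A :: 'n sq_matrix. A $ i $ j)" for i j
    by (intro continuous_intros)
  have "closed {A :: 'n sq_matrix. transpose A = A}"
  proof -
    have "{A :: 'n sq_matrix. transpose A = A} = (\<Inter>i. \<Inter>j. {A. A $ j $ i = A $ i $ j})"
      by (auto simp: transpose_def vec_eq_iff)
    also have "closed \<dots>"
      by (intro closed_INT ballI closed_Collect_eq entry)
    finally show ?thesis .
  qed
  \<comment> \<open>For each fixed \<open>x\<close> both sides are continuous in \<open>A\<close>,
    so the set is an intersection of closed sets, even over uncountably many
    \<open>x\<close>.\<close>
  moreover have "closed {A :: 'n sq_matrix. \<forall>x. x \<bullet> x / real (Suc m) \<le> x \<bullet> (A *v x)}" for m
    unfolding quadratic_form_sum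
    by (intro closed_Collect_all closed_Collect_le continuous_intros)
  moreover have "{A :: 'n sq_matrix. positive_definite A} =
      {A. transpose A = A} \<inter> (\<Union>m. {A. \<forall>x. x \<bullet> x / real (Suc m) \<le> x \<bullet> (A *v x)})"
    using positive_definite_iff_uniform by blast
  ultimately show ?thesis
    by (auto simp del: of_nat_Suc intro!: sets.Int sets.countable_UN borel_closed)
qed

lemma measurable_sym_matrix_entry [measurable]:
  "(\<lambda>u :: 'n::{finite,linorder} \<times> 'n \<Rightarrow> real. sym_matrix u $ i $ j) \<in> borel_measurable upper_lborel"
proof -
  \<comment> \<open>The pair \<open>(min i j, max i j)\<close> always lies in the index set of the
    product measure, so this is a genuine coordinate projection.\<close>
  have "(\<lambda>u :: 'n \<times> 'n \<Rightarrow> real. u (min i j, max i j)) \<in> measurable upper_lborel lborel"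
    unfolding upper_lborel_def by (rule measurable_component_singleton) (auto simp: min_le_iff_disj)
  then show ?thesis by (simp add: sym_matrix_def)
qed

lemma measurable_sym_matrix [measurable]:
  "sym_matrix \<in> borel_measurable (upper_lborel :: ('n::{finite,linorder} \<times> 'n \<Rightarrow> real) measure)"
proof (subst borel_measurable_euclidean_space, rule ballI)
  fix b :: "'n sq_matrix"
  assume "b \<in> Basis"
  then obtain i j where "b = axis i (axis j 1)"
    by (auto simp: Basis_vec_def)
  then show "(\<lambda>u. sym_matrix u \<bullet> b) \<in> borel_measurable upper_lborel"
    by (simp add: inner_axis)
qed

lemma measurable_posterior_density:
  fixes S :: "'n::{finite,linorder} sq_matrix"
  assumes \<pi>\<^sub>D: "continuous_on {0<..} \<pi>\<^sub>D" and \<pi>: "continuous_on UNIV \<pi>"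
  shows "(\<lambda>u. posterior_density \<pi>\<^sub>D \<pi> n S (sym_matrix u)) \<in> borel_measurable upper_lborel"
proof -
  \<comment> \<open>Outside the positive reals \<open>\<pi>\<^sub>D\<close> is arbitrary and may
    fail to be measurable. Cutting it off to 0 there leaves the density unchanged, since positive
    definite matrices have positive diagonals.\<close>
  define g where "g x = indicator {0<..} x *\<^sub>R \<pi>\<^sub>D x" for x
  have [measurable]: "g \<in> borel_measurable borel"
    using borel_measurable_continuous_on_indicator[OF _ \<pi>\<^sub>D] by (simp add: g_def[abs_def])
  have [measurable]: "\<pi> \<in> borel_measurable borel"
    using \<pi> by (rule borel_measurable_continuous_onI)
  have eq: "posterior_density \<pi>\<^sub>D \<pi> n S A =
    det A powr (real n / 2) * exp (- (real n / 2) * trace (S ** A)) *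
      ((\<Prod>i\<in>UNIV. g (A $ i $ i)) * (\<Prod>(i, j)\<in>{(i, j). i < j}. \<pi> (A $ i $ j)) *
       indicator {A. positive_definite A} A)" for A
    by (auto simp: posterior_density_def prior_density_def indicator_def g_def
        positive_definite_diag_pos)
  show ?thesis
    unfolding eq det_def trace_def matrix_matrix_mult_def vec_lambda_beta split_beta
    by measurable
qed

section \<open>Domination by a product of one-variable functions\<close>

lemma posterior_density_bound:
  fixes S A :: "'n::{finite,linorder} sq_matrix"
  assumes \<pi>\<^sub>D: "\<And>x. 0 < x \<Longrightarrow> 0 \<le> \<pi>\<^sub>D x" and \<pi>: "\<And>x. 0 \<le> \<pi> x"
    and S: "positive_semidefinite S" and A: "positive_definite A"
  shows "\<bar>posterior_density \<pi>\<^sub>D \<pi> n S A\<bar> \<le> fact CARD('n) powr (real n / 2) *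
    ((\<Prod>i\<in>UNIV. A $ i $ i powr (real n / 2) * \<pi>\<^sub>D (A $ i $ i)) *
     (\<Prod>(i, j)\<in>{(i, j). i < j}. \<pi> (A $ i $ j)))"
proof -
  let ?a = "real n / 2"
  let ?P = "\<Prod>i\<in>UNIV. \<pi>\<^sub>D (A $ i $ i)" and ?Q = "\<Prod>(i, j)\<in>{(i, j). i < j}. \<pi> (A $ i $ j)"
  note diag = positive_definite_diag_pos[OF A]
  have P: "0 \<le> ?P" and Q: "0 \<le> ?Q"
    using diag by (auto intro!: prod_nonneg \<pi>\<^sub>D \<pi>)
  then have PQ: "0 \<le> ?P * ?Q"
    by simp
  \<comment> \<open>Real \<open>powr\<close> depends only on the absolute value of its base, so the
    bound on the absolute determinant applies without determining its sign.\<close>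
  have "det A powr ?a = \<bar>det A\<bar> powr ?a"
    by (simp add: abs_if uminus_powr_eq)
  also have "\<dots> \<le> (fact CARD('n) * (\<Prod>i\<in>UNIV. A $ i $ i)) powr ?a"
    by (intro powr_mono2 abs_det_le_prod_diag[OF A]) auto
  also have "\<dots> = fact CARD('n) powr ?a * (\<Prod>i\<in>UNIV. A $ i $ i powr ?a)"
    by (simp add: powr_mult prod_powr_distrib)
  finally have det: "det A powr ?a \<le> fact CARD('n) powr ?a * (\<Prod>i\<in>UNIV. A $ i $ i powr ?a)" .
  have "exp (- ?a * trace (S ** A)) \<le> 1"
    using trace_mult_nonneg[OF S A] by simp
  then have "det A powr ?a * exp (- ?a * trace (S ** A)) \<le>
      (fact CARD('n) powr ?a * (\<Prod>i\<in>UNIV. A $ i $ i powr ?a)) * 1"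
    using det by (intro mult_mono) (auto intro!: mult_nonneg_nonneg prod_nonneg)
  then have "det A powr ?a * exp (- ?a * trace (S ** A)) * (?P * ?Q) \<le>
      fact CARD('n) powr ?a * (\<Prod>i\<in>UNIV. A $ i $ i powr ?a) * (?P * ?Q)"
    using PQ by (intro mult_right_mono) auto
  then show ?thesis
    using A by (simp add: posterior_density_def prior_density_def abs_mult prod.distrib
        abs_of_nonneg[OF P] abs_of_nonneg[OF Q] mult_ac)
qed

theorem proposition13:
  fixes S :: "('n::{finite,linorder}) sq_matrix"
    and n :: nat
    and \<pi>\<^sub>D \<pi> :: "real \<Rightarrow> real"
  assumes "continuous_on {0<..} \<pi>\<^sub>D"
    and "\<And>x. 0 < x \<Longrightarrow> 0 \<le> \<pi>\<^sub>D x"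
    and "continuous_on UNIV \<pi>"
    and "\<And>x. 0 \<le> \<pi> x"
    and "positive_semidefinite S"
    and "1 \<le> n"
    and "integrable lborel \<pi>"
    and "set_integrable lborel {0<..} (\<lambda>x. x powr (real n / 2) * \<pi>\<^sub>D x)"
  shows "proper_posterior \<pi>\<^sub>D \<pi> n S"
proof -
  let ?a = "real n / 2" and ?K = "{(i, j). i \<le> j} :: ('n \<times> 'n) set"
  let ?L = "{(i, j). i < j} :: ('n \<times> 'n) set"
  define h where "h x = indicator {0<..} x * (x powr ?a * \<pi>\<^sub>D x)" for x
  \<comment> \<open>One family of integrable factors over all upper triangular positions, the shape
    required for integrating a finite product over a product measure.\<close>
  define F where "F ij = (if fst ij = snd ij then h else \<pi>)" for ij :: "'n \<times> 'n"
  define G where "G u = fact CARD('n) powr ?a * (\<Prod>ij\<in>?K. F ij (u ij))" for u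
  interpret product_sigma_finite "\<lambda>ij :: 'n \<times> 'n. lborel :: real measure"
    by standard
  have h: "integrable lborel h"
    using assms(8) by (simp add: set_integrable_def h_def[abs_def])
  have "integrable upper_lborel G"
    unfolding upper_lborel_def G_def using h assms(7)
    by (intro integrable_mult_right product_integrable_prod) (auto simp: F_def)
  moreover have "(\<lambda>u. posterior_density \<pi>\<^sub>D \<pi> n S (sym_matrix u)) \<in> borel_measurable upper_lborel"
    by (rule measurable_posterior_density[OF assms(1,3)])
  \<comment> \<open>Off the cone the density is 0. On it, the product defining \<open>G\<close>
    splits into its diagonal and strictly upper parts, where the cutoff in \<open>h\<close> equals
    1.\<close>
  moreover have "norm (posterior_density \<pi>\<^sub>D \<pi> n S (sym_matrix u)) \<le> norm (G u)" for u
  proof (cases "positive_definite (sym_matrix u)")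
    case False
    then show ?thesis by (simp add: posterior_density_def prior_density_def)
  next
    case True
    let ?A = "sym_matrix u"
    have K: "?K = (\<lambda>i. (i, i)) ` UNIV \<union> ?L" by auto
    have "(\<Prod>ij\<in>?K. F ij (u ij)) = (\<Prod>ij\<in>(\<lambda>i. (i, i)) ` UNIV. F ij (u ij)) * (\<Prod>ij\<in>?L. F ij (u ij))"
      unfolding K by (rule prod.union_disjoint) auto
    also have "(\<Prod>ij\<in>(\<lambda>i. (i, i)) ` UNIV. F ij (u ij)) =
        (\<Prod>i\<in>UNIV. ?A $ i $ i powr ?a * \<pi>\<^sub>D (?A $ i $ i))"
      using positive_definite_diag_pos[OF True]
      by (subst prod.reindex) (auto simp: inj_on_def F_def h_def sym_matrix_def)
    also have "(\<Prod>ij\<in>?L. F ij (u ij)) = (\<Prod>(i, j)\<in>?L. \<pi> (?A $ i $ j))"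
      by (intro prod.cong) (auto simp: F_def sym_matrix_def)
    finally have "G u = fact CARD('n) powr ?a *
        ((\<Prod>i\<in>UNIV. ?A $ i $ i powr ?a * \<pi>\<^sub>D (?A $ i $ i)) * (\<Prod>(i, j)\<in>?L. \<pi> (?A $ i $ j)))"
      by (simp add: G_def)
    then have "norm (posterior_density \<pi>\<^sub>D \<pi> n S ?A) \<le> G u"
      using posterior_density_bound[OF assms(2,4,5) True] by simp
    then show ?thesis by simp
  qed
  ultimately show ?thesis
    unfolding proper_posterior_def by (rule Bochner_Integration.integrable_bound[OF _ _ AE_I2])
qed

end
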